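(* Let $\alpha\in(0,1]$ and let $h$ be an $\alpha$-strong function. Let $F$ be a distribution function as in the context. For $n\ge1$ consider the threshold algorithm on $n$ i.i.d. items $X_1,\dots,X_n$ with distribution $F$ that uses thresholds $\theta_i=F^{-1}\!\big(h(i/n)/h((i-1)/n)\big)$, $i=1,\dots,n$, and picks the first item $i$ with $X_i\ge\theta_i$ (value $0$ if none). Then for every $\epsilon>0$ there exists $n_\epsilon$ such that for every $n\geq n_\epsilon$ this algorithm is at least a $(1-\epsilon)\alpha$-approximation, i.e. $\mathbb{E}[X_\tau]\ge(1-\epsilon)\alpha\,\mathbb{E}[\max_i X_i]$ where $X_\tau$ is the picked value.
   Context: $F$ is the distribution function of a nonnegative random variable, continuous and strictly increasing on a subinterval of $\mathbb{R}_{\ge0}$. A threshold function is a continuous, strictly decreasing, differentiable function $h:[0,1]\to[0,1]$ with $h(0)=1$ and $h>0$ on $[0,1]$ (so that $h'/h$ is defined), such that (i) $h$ is strictly concave, and (ii) for every $\epsilon>0$ there exists $\delta_0\le\epsilon$ such that for every $\delta\le\delta_0$ and every $s$ with $\epsilon+\delta\le s\le1$, $\frac{h'(s-\delta)}{h(s-\delta)}\le(1-\epsilon)\frac{h'(s)}{h(s)}$. A threshold function $h$ is $\alpha$-strong if (i) $h(1)\le 1-\alpha$; (ii) $\int_0^1 h(r)\,dr\ge\alpha$; (iii) for all $0\le s\le1$, $1-h(s)-\frac{h'(s)}{h(s)}\int_s^1 h(r)\,dr\ \ge\ \alpha\left(1-\exp\!\left(\frac{h'(s)}{h(s)}\right)\right)$.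 Items are revealed in order and each must be irrevocably accepted (stopping) or rejected. *)

theory Defs
  imports "HOL-Probability.Probability"
begin

definition strictly_concave_on :: "real set \<Rightarrow> (real \<Rightarrow> real) \<Rightarrow> bool" where
  "strictly_concave_on S f \<longleftrightarrow> convex S \<and>
     (\<forall>x\<in>S. \<forall>y\<in>S. \<forall>t. x \<noteq> y \<longrightarrow> 0 < t \<longrightarrow> t < 1 \<longrightarrow>
        (1 - t) * f x + t * f y < f ((1 - t) * x + t * y))"

text \<open>The derivative relative to the domain \<open>[0,1]\<close>, hence one-sided at the endpoints.\<close>

definition unit_deriv :: "(real \<Rightarrow> real) \<Rightarrow> real \<Rightarrow> real" where
  "unit_deriv h s = vector_derivative h (at s within {0..1})"

lemma unit_deriv_eqI:
  assumes "s \<in> {0..1}" "(h has_real_derivative D) (at s within {0..1})"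
  shows "unit_deriv h s = D"
  using assms
  by (simp add: unit_deriv_def has_real_derivative_iff_has_vector_derivative
      vector_derivative_within_closed_interval)

definition threshold_function :: "(real \<Rightarrow> real) \<Rightarrow> bool" where
  "threshold_function h \<longleftrightarrow>
     h \<in> {0..1} \<rightarrow> {0..1} \<and> continuous_on {0..1} h \<and> strict_antimono_on {0..1} h \<and>
     h differentiable_on {0..1} \<and> h 0 = 1 \<and> (\<forall>s\<in>{0..1}. 0 < h s) \<and>
     strictly_concave_on {0..1} h \<and>
     (\<forall>\<epsilon>>0. \<exists>\<delta>\<^sub>0>0. \<delta>\<^sub>0 \<le> \<epsilon> \<and>
        (\<forall>\<delta> s. 0 < \<delta> \<longrightarrow> \<delta> \<le> \<delta>\<^sub>0 \<longrightarrow> \<epsilon> + \<delta> \<le> s \<longrightarrow> s \<le> 1 \<longrightarrow>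
           unit_deriv h (s - \<delta>) / h (s - \<delta>) \<le> (1 - \<epsilon>) * (unit_deriv h s / h s)))"

definition strong_threshold :: "real \<Rightarrow> (real \<Rightarrow> real) \<Rightarrow> bool" where
  "strong_threshold \<alpha> h \<longleftrightarrow> threshold_function h \<and>
     h 1 \<le> 1 - \<alpha> \<and>
     \<alpha> \<le> integral {0..1} h \<and>
     (\<forall>s\<in>{0..1}. \<alpha> * (1 - exp (unit_deriv h s / h s))
        \<le> 1 - h s - unit_deriv h s / h s * integral {s..1} h)"

definition nonneg_distribution_function :: "(real \<Rightarrow> real) \<Rightarrow> bool" where
  "nonneg_distribution_function F \<longleftrightarrow>
     (\<exists>D. real_distribution D \<and> (AE x in D. 0 \<le> x) \<and> cdf D = F)"

text \<open>\<open>I\<close> is the interval on which \<open>F\<close> climbs from 0 to 1. Together with continuity, the last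
  condition makes \<open>F\<close> restricted to \<open>I\<close> invertible at every level strictly between 0 and 1.\<close>

definition continuous_increasing_on_interval :: "(real \<Rightarrow> real) \<Rightarrow> real set \<Rightarrow> bool" where
  "continuous_increasing_on_interval F I \<longleftrightarrow>
     continuous_on UNIV F \<and> is_interval I \<and> I \<subseteq> {0..} \<and> strict_mono_on I F \<and>
     (\<forall>x. 0 < F x \<and> F x < 1 \<longrightarrow> x \<in> I)"

definition threshold :: "(real \<Rightarrow> real) \<Rightarrow> (real \<Rightarrow> real) \<Rightarrow> real set \<Rightarrow> nat \<Rightarrow> nat \<Rightarrow> real" where
  "threshold h F I n i = the_inv_into I F (h (real i / real n) / h ((real i - 1) / real n))"

definition picked_value :: "nat \<Rightarrow> (nat \<Rightarrow> real) \<Rightarrow> (nat \<Rightarrow> real) \<Rightarrow> real" where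
  "picked_value n \<theta> x =
     (if \<exists>i\<in>{1..n}. \<theta> i \<le> x i then x (LEAST i. i \<in> {1..n} \<and> \<theta> i \<le> x i) else 0)"

definition iid_items :: "'a measure \<Rightarrow> nat \<Rightarrow> (nat \<Rightarrow> 'a \<Rightarrow> real) \<Rightarrow> (real \<Rightarrow> real) \<Rightarrow> bool" where
  "iid_items M n X F \<longleftrightarrow> prob_space M \<and>
     prob_space.indep_vars M (\<lambda>_. borel) X {1..n} \<and>
     (\<forall>i\<in>{1..n}. cdf (distr M borel (X i)) = F)"

end

theory Submission
  imports Defs
begin

text \<open>Both expectations are integrals of tail probabilities, so it suffices to compare the tails at
  each level \<open>t\<close>. Put \<open>z = 1 - F t\<close>. Item \<open>i + 1\<close> is reached with probability \<open>h (i/n)\<close>, so the picked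
  value exceeds \<open>t\<close> with probability \<open>\<Sum>i<n. min (h (i/n) - h ((i+1)/n)) (z * h (i/n))\<close>. As \<open>h\<close> is
  log-concave, the first term is the smaller one exactly on an initial segment \<open>i < k\<close>; comparing
  the remaining sum with an integral gives the lower bound \<open>1 - h s + c * integral {s..1} h\<close> with
  \<open>s = k/n\<close> and \<open>c = n * z\<close>. Minimise this over \<open>s\<close>: at an interior minimum \<open>c = - h' s / h s\<close>,
  and at the end points the other two conditions of an \<open>\<alpha>\<close>-strong function apply, so it is always at
  least \<open>\<alpha> * (1 - exp (- c))\<close>. Finally \<open>1 - (1 - c/n)^n \<le> (1 + 2/n) * (1 - exp (- c))\<close>.\<close>

section \<open>Analysis of strong threshold functions\<close>

text \<open>With \<open>u = c / n\<close>, the bound \<open>1 + u \<le> exp u\<close> and Bernoulli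
  give \<open>(1 - n u^2) exp (- c) \<le> (1 - u)^n\<close>. Since
  \<open>c^2 \<le> 2 (exp c - 1)\<close>, the error \<open>c^2 exp (- c) / n\<close> is at most
  \<open>2/n\<close> times \<open>1 - exp (- c)\<close> itself. The loss is relative and uniform in
  \<open>c\<close>, so one \<open>n\<close> serves every level \<open>t\<close>.\<close>

lemma one_minus_power_le_one_minus_exp:
  fixes c :: real
  assumes "0 \<le> c" "c \<le> real n" "1 \<le> n"
  shows "1 - (1 - c / real n) ^ n \<le> (1 + 2 / real n) * (1 - exp (- c))"
proof -
  define u where "u = c / real n"
  have u: "0 \<le> u" "u \<le> 1" and c: "c = real n * u"
    using assms by (auto simp: u_def)
  have u2: "u\<^sup>2 \<le> 1"
    using u by (simp add: power_le_one)
  have "1 - real n * u\<^sup>2 \<le> (1 - u\<^sup>2) ^ n"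
    using Bernoulli_inequality[of "- (u\<^sup>2)" n] u2 by simp
  also have "\<dots> = ((1 - u) * (1 + u)) ^ n"
    by (simp add: algebra_simps power2_eq_square)
  also have "\<dots> \<le> ((1 - u) * exp u) ^ n"
    using u by (intro power_mono mult_left_mono) auto
  also have "\<dots> = (1 - u) ^ n * exp c"
    by (simp add: power_mult_distrib c exp_of_nat_mult)
  finally have "(1 - real n * u\<^sup>2) * exp (- c) \<le> (1 - u) ^ n * exp c * exp (- c)"
    by (intro mult_right_mono) auto
  moreover have "exp c * exp (- c) = 1"
    by (simp add: exp_minus)
  ultimately have A: "(1 - real n * u\<^sup>2) * exp (- c) \<le> (1 - u) ^ n"
    by (simp only: mult.assoc mult_1_right)
  have "c\<^sup>2 \<le> 2 * (exp c - 1)"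
    using exp_lower_Taylor_quadratic[of c] assms by simp
  then have "c\<^sup>2 * exp (- c) \<le> 2 * (exp c - 1) * exp (- c)"
    by (intro mult_right_mono) auto
  also have "\<dots> = 2 * (1 - exp (- c))"
    by (simp add: exp_minus field_simps)
  finally have "c\<^sup>2 * exp (- c) / real n \<le> 2 * (1 - exp (- c)) / real n"
    using assms by (intro divide_right_mono) auto
  moreover have "real n * u\<^sup>2 = c\<^sup>2 / real n"
    using assms by (simp add: c power2_eq_square)
  ultimately show ?thesis
    using A unfolding u_def by (simp add: algebra_simps)
qed

text \<open>Here \<open>c\<close> and \<open>s\<close> are independent: \<open>c\<close> comes from
  the level, \<open>s\<close> from the index at which the minimum in the tail sum switches.
  Minimising over \<open>s\<close> links them in the way the definition of strength demands.\<close>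

lemma strong_threshold_lower_bound:
  assumes \<alpha>: "0 < \<alpha>" and h: "strong_threshold \<alpha> h" and c: "0 \<le> c" and s: "s \<in> {0..1}"
  shows "\<alpha> * (1 - exp (- c)) \<le> 1 - h s + c * integral {s..1} h"
proof -
  from h have th: "threshold_function h"
    and h1: "h 1 \<le> 1 - \<alpha>" and hI: "\<alpha> \<le> integral {0..1} h"
    and h3: "\<And>s. s \<in> {0..1} \<Longrightarrow> \<alpha> * (1 - exp (unit_deriv h s / h s))
        \<le> 1 - h s - unit_deriv h s / h s * integral {s..1} h"
    unfolding strong_threshold_def by auto
  from th have cont: "continuous_on {0..1} h" and diff: "h differentiable_on {0..1}"
    and h0: "h 0 = 1" and pos: "\<And>s. s \<in> {0..1} \<Longrightarrow> 0 < h s"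
    unfolding threshold_function_def by auto
  have int: "h integrable_on {0..1}"
    using cont by (rule integrable_continuous_real)
  \<comment> \<open>Expressing the tail integral through integrals with lower limit 0 makes the
    fundamental theorem applicable to \<open>\<phi>\<close>.\<close>
  define \<phi> where "\<phi> s = 1 - h s + c * (integral {0..1} h - integral {0..s} h)" for s
  have \<phi>: "\<phi> s = 1 - h s + c * integral {s..1} h" if "s \<in> {0..1}" for s
    using Henstock_Kurzweil_Integration.integral_combine[of 0 s 1 h] int that
    unfolding \<phi>_def by (metis add_diff_cancel_left' atLeastAtMost_iff)
  have "continuous_on {0..1} \<phi>"
    unfolding \<phi>_def by (intro continuous_intros cont indefinite_integral_continuous_1 int)
  then obtain m where m: "m \<in> {0..1}" and min: "\<And>y. y \<in> {0..1} \<Longrightarrow> \<phi> m \<le> \<phi> y"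
    using continuous_attains_inf[of "{0..1::real}" \<phi>] by auto
  \<comment> \<open>The first bound serves a minimum at 1, where \<open>\<phi> 1 = 1 - h 1\<close>
    is at least \<alpha>. The second serves a minimum at 0, where
    \<open>\<phi> 0 = c * integral {0..1} h\<close> is at least \<open>c * \<alpha>\<close>.\<close>
  have e: "1 - exp (- c) \<le> 1" "1 - exp (- c) \<le> c"
    using exp_ge_add_one_self[of "- c"] by auto
  consider "m = 0" | "m = 1" | "0 < m" "m < 1"
    using m by force
  then have "\<alpha> * (1 - exp (- c)) \<le> \<phi> m"
  proof cases
    case 1
    have "\<alpha> * (1 - exp (- c)) \<le> \<alpha> * c"
      using e \<alpha> by simp
    also have "\<dots> \<le> c * integral {0..1} h"
      using mult_right_mono[OF hI c] by (simp add: mult.commute)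
    finally show ?thesis
      using 1 h0 by (simp add: \<phi>)
  next
    case 2
    have "\<alpha> * (1 - exp (- c)) \<le> \<alpha>"
      using e \<alpha> by simp
    then show ?thesis
      using 2 h1 by (simp add: \<phi>)
  next
    case 3
    \<comment> \<open>In the interior the relative derivative is two-sided, so the vanishing
      derivative of \<open>\<phi>\<close> forces \<open>c = - d / h m\<close>, exactly the slope for
      which the third strength condition at \<open>m\<close> is stated.\<close>
    have at: "at m within {0..1} = at m"
      using 3 by (rule at_within_Icc_at)
    from diff m obtain d where d: "(h has_real_derivative d) (at m within {0..1})"
      unfolding differentiable_on_def by (meson real_differentiable_def)
    have ud: "unit_deriv h m = d"
      using m d by (rule unit_deriv_eqI)
    have "((\<lambda>s. integral {0..s} h) has_real_derivative h m) (at m within {0..1})"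
      using cont m by (rule integral_has_real_derivative)
    then have "(\<phi> has_real_derivative (0 - d + c * (0 - h m))) (at m)"
      using d unfolding \<phi>_def at by (auto intro!: derivative_eq_intros)
    then have "0 - d + c * (0 - h m) = 0"
    proof (rule DERIV_local_min)
      show "0 < min m (1 - m)" using 3 by simp
      show "\<forall>y. \<bar>m - y\<bar> < min m (1 - m) \<longrightarrow> \<phi> m \<le> \<phi> y"
      proof (intro allI impI min)
        fix y assume "\<bar>m - y\<bar> < min m (1 - m)"
        then show "y \<in> {0..1}" by auto
      qed
    qed
    then have "c = - (d / h m)"
      using pos[OF m] by (simp add: field_simps)
    then show ?thesis
      using h3[OF m] m by (simp add: ud \<phi>)
  qed
  also have "\<dots> \<le> \<phi> s"
    using min s by simp
  finally show ?thesis
    using s by (simp add: \<phi>)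
qed

text \<open>On each cell of length \<open>1/n\<close> the decreasing \<open>h\<close> is at most its
  left-end value. The induction runs downwards from \<open>k = n\<close>, where the integral is over
  a point, and adds one cell per step.\<close>

lemma integral_le_left_Riemann_sum:
  fixes h :: "real \<Rightarrow> real"
  assumes anti: "antimono_on {0..1} h" and int: "h integrable_on {0..1}"
    and "k \<le> n" "1 \<le> n"
  shows "real n * integral {real k / real n..1} h \<le> (\<Sum>i=k..<n. h (real i / real n))"
  using \<open>k \<le> n\<close>
proof (induction rule: inc_induct)
  case base
  then show ?case using \<open>1 \<le> n\<close> by simp
next
  case (step k)
  define a where "a = real k / real n"
  define b where "b = real (Suc k) / real n"
  have ab: "0 \<le> a" "a \<le> b" "b \<le> 1"
    using step.hyps by (auto simp: a_def b_def divide_simps)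
  have "integral {a..b} h \<le> integral {a..b} (\<lambda>_. h a)"
    using ab by (intro integral_le integrable_on_subinterval[OF int] monotone_onD[OF anti]) auto
  also have "\<dots> = h a / real n"
    using \<open>1 \<le> n\<close> ab by (simp add: a_def b_def field_simps)
  finally have "real n * integral {a..b} h \<le> h a"
    using \<open>1 \<le> n\<close> by (simp add: field_simps)
  moreover have "integral {a..1} h = integral {a..b} h + integral {b..1} h"
    using ab by (intro Henstock_Kurzweil_Integration.integral_combine[symmetric]
        integrable_on_subinterval[OF int]) auto
  ultimately show ?case
    using step unfolding a_def b_def by (simp add: sum.atLeast_Suc_lessThan algebra_simps)
qed

text \<open>Log-concavity says that the ratios \<open>a (i+1) / a i\<close> decrease, so once such a
  ratio is below \<open>1 - z\<close> it stays there. Hence the minimum switches only once: the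
  decrements before \<open>k\<close> telescope, and the terms from \<open>k\<close> on are
  \<open>z * a i\<close>.\<close>

lemma sum_min_decrement_eq:
  fixes a :: "nat \<Rightarrow> real"
  assumes pos: "\<And>i. i \<le> n \<Longrightarrow> 0 < a i"
    and lc: "\<And>i. i + 2 \<le> n \<Longrightarrow> a i * a (i + 2) \<le> (a (i + 1))\<^sup>2"
  obtains k where "k \<le> n"
    "(\<Sum>i<n. min (a i - a (Suc i)) (z * a i)) = a 0 - a k + z * (\<Sum>i=k..<n. a i)"
proof -
  \<comment> \<open>The disjunct \<open>i = n\<close> guarantees a least index; \<open>k = n\<close>
    means that the switch never happens.\<close>
  define P where "P i \<longleftrightarrow> i = n \<or> z * a i < a i - a (Suc i)" for i
  define k where "k = (LEAST i. P i)"
  have "P n" by (simp add: P_def)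
  then have kn: "k \<le> n" and Pk: "P k"
    unfolding k_def by (auto intro: Least_le LeastI)
  have below: "a i - a (Suc i) \<le> z * a i" if "i < k" for i
    using not_less_Least[of i P] that by (auto simp: k_def P_def)
  have "z * a i < a i - a (Suc i)" if "k \<le> i" "i < n" for i
    using that
  proof (induction i rule: dec_induct)
    case base
    then show ?case using Pk by (auto simp: P_def)
  next
    case (step i)
    have "a (Suc i) < (1 - z) * a i"
      using step by (simp add: algebra_simps)
    then have "a (Suc i) * a (Suc i) < (1 - z) * a i * a (Suc i)"
      using pos[of "Suc i"] step by simp
    \<comment> \<open>Log-concavity passes the strict bound from index \<open>i\<close> to the next
      one, after cancelling \<open>a i\<close>.\<close>
    moreover have "a i * a (Suc (Suc i)) \<le> a (Suc i) * a (Suc i)"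
      using lc[of i] step by (simp add: power2_eq_square)
    ultimately have "a i * a (Suc (Suc i)) < a i * ((1 - z) * a (Suc i))"
      by (simp add: algebra_simps)
    then have "a (Suc (Suc i)) < (1 - z) * a (Suc i)"
      using pos[of i] step by simp
    then show ?case by (simp add: algebra_simps)
  qed
  then have above: "z * a i \<le> a i - a (Suc i)" if "k \<le> i" "i < n" for i
    using that less_imp_le by blast
  have "(\<Sum>i<n. min (a i - a (Suc i)) (z * a i)) =
      (\<Sum>i<k. min (a i - a (Suc i)) (z * a i)) + (\<Sum>i=k..<n. min (a i - a (Suc i)) (z * a i))"
    unfolding lessThan_atLeast0 using kn by (intro sum.atLeastLessThan_concat[symmetric]) auto
  also have "(\<Sum>i<k. min (a i - a (Suc i)) (z * a i)) = (\<Sum>i<k. a i - a (Suc i))"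
    using below by (intro sum.cong) (auto simp: min_def)
  also have "\<dots> = a 0 - a k"
    by (rule sum_lessThan_telescope')
  also have "(\<Sum>i=k..<n. min (a i - a (Suc i)) (z * a i)) = z * (\<Sum>i=k..<n. a i)"
    using above by (simp add: sum_distrib_left min_absorb2)
  finally show thesis using that kn by blast
qed

text \<open>Concavity puts the midpoint value above the arithmetic mean, which dominates the
  geometric mean.\<close>

lemma strictly_concave_on_log_concave:
  assumes "strictly_concave_on S f" "x \<in> S" "y \<in> S" "0 < f x" "0 < f y"
  shows "f x * f y \<le> (f ((x + y) / 2))\<^sup>2"
proof -
  have mid: "(f x + f y) / 2 \<le> f ((x + y) / 2)"
  proof (cases "x = y")
    case False
    have "\<And>t. 0 < t \<Longrightarrow> t < 1 \<Longrightarrow> (1 - t) * f x + t * f y < f ((1 - t) * x + t * y)"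
      using assms False unfolding strictly_concave_on_def by blast
    from this[of "1/2"] show ?thesis by (simp add: add_divide_distrib)
  qed simp
  have "f x * f y \<le> ((f x + f y) / 2)\<^sup>2"
    using zero_le_power2[of "f x - f y"] by (simp add: power2_eq_square field_simps)
  also have "\<dots> \<le> (f ((x + y) / 2))\<^sup>2"
    using assms mid by (intro power_mono) auto
  finally show ?thesis .
qed

text \<open>Here \<open>z\<close> stands for the chance that a single item exceeds the level. The
  left side then concerns the maximum of all items, and the sum will bound from below the chance
  that the picked value exceeds the level.\<close>

lemma strong_threshold_tail_bound:
  fixes z :: real
  assumes \<alpha>: "0 < \<alpha>" and h: "strong_threshold \<alpha> h" and n: "1 \<le> n" and z: "0 \<le> z" "z \<le> 1"
  shows "\<alpha> * (1 - (1 - z) ^ n) \<le> (1 + 2 / real n) *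
    (\<Sum>i<n. min (h (real i / real n) - h (real (Suc i) / real n)) (z * h (real i / real n)))"
proof -
  from h have th: "threshold_function h"
    unfolding strong_threshold_def by auto
  then have cont: "continuous_on {0..1} h" and anti: "strict_antimono_on {0..1} h"
    and h0: "h 0 = 1" and pos: "\<And>s. s \<in> {0..1} \<Longrightarrow> 0 < h s"
    and conc: "strictly_concave_on {0..1} h"
    unfolding threshold_function_def by auto
  define a where "a i = h (real i / real n)" for i
  have dom: "real i / real n \<in> {0..1}" if "i \<le> n" for i
    using that by (auto simp: divide_simps)
  have a_pos: "0 < a i" if "i \<le> n" for i
    unfolding a_def using that by (intro pos dom)
  have a_lc: "a i * a (i + 2) \<le> (a (i + 1))\<^sup>2" if "i + 2 \<le> n" for i
  proof -
    have "(real i / real n + real (i + 2) / real n) / 2 = real (i + 1) / real n"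
      by (simp add: add_divide_distrib)
    then show ?thesis
      using strictly_concave_on_log_concave[OF conc, of "real i / real n" "real (i + 2) / real n"]
        dom[of i] dom[of "i + 2"] pos that
      unfolding a_def by (metis add_leD1)
  qed
  obtain k where k: "k \<le> n" and
    sum: "(\<Sum>i<n. min (a i - a (Suc i)) (z * a i)) = a 0 - a k + z * (\<Sum>i=k..<n. a i)"
    by (rule sum_min_decrement_eq[of n a z, OF a_pos a_lc])
  \<comment> \<open>This scaling turns \<open>(1 - z)^n\<close> into \<open>(1 - c/n)^n\<close> and
    makes \<open>z\<close> times the Riemann sum at least \<open>c\<close> times the
    integral.\<close>
  define c where "c = real n * z"
  have c: "0 \<le> c" "c \<le> real n" "z = c / real n"
    using z n by (auto simp: c_def mult_left_le)
  have "antimono_on {0..1} h"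
    using anti by (auto simp: monotone_on_def less_le)
  then have "real n * integral {real k / real n..1} h \<le> (\<Sum>i=k..<n. a i)"
    unfolding a_def using k n cont
    by (intro integral_le_left_Riemann_sum) (auto intro: integrable_continuous_real)
  then have "z * (real n * integral {real k / real n..1} h) \<le> z * (\<Sum>i=k..<n. a i)"
    using z by (intro mult_left_mono)
  then have le: "1 - h (real k / real n) + c * integral {real k / real n..1} h
      \<le> (\<Sum>i<n. min (a i - a (Suc i)) (z * a i))"
    unfolding sum using h0 by (simp add: a_def c_def algebra_simps)
  have "\<alpha> * (1 - (1 - z) ^ n) \<le> \<alpha> * ((1 + 2 / real n) * (1 - exp (- c)))"
    using one_minus_power_le_one_minus_exp[OF c(1,2) n] \<alpha> unfolding c(3) by simp
  also have "\<dots> = (1 + 2 / real n) * (\<alpha> * (1 - exp (- c)))"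
    by simp
  also have "\<dots> \<le> (1 + 2 / real n) * (\<Sum>i<n. min (a i - a (Suc i)) (z * a i))"
    using strong_threshold_lower_bound[OF \<alpha> h c(1) dom[OF k]] le
    by (intro mult_left_mono) auto
  finally show ?thesis
    unfolding a_def .
qed

section \<open>Tail probabilities\<close>

text \<open>Allows a constant to be moved into the integral over \<open>t\<close> later on. The tail
  is a section integral of a jointly measurable indicator.\<close>

lemma borel_measurable_tail:
  fixes f :: "'a \<Rightarrow> real"
  assumes "sigma_finite_measure M" and [measurable]: "f \<in> borel_measurable M"
  shows "(\<lambda>t. emeasure M {\<omega> \<in> space M. t < f \<omega>}) \<in> borel_measurable lborel"
proof -
  interpret sigma_finite_measure M by fact
  have "(\<lambda>t. emeasure M {\<omega> \<in> space M. t < f \<omega>}) =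
      (\<lambda>t. \<integral>\<^sup>+\<omega>. (if t < f \<omega> then 1 else 0) \<partial>M)"
  proof
    fix t
    have "emeasure M {\<omega> \<in> space M. t < f \<omega>} = (\<integral>\<^sup>+\<omega>. indicator {\<omega> \<in> space M. t < f \<omega>} \<omega> \<partial>M)"
      by simp
    also have "\<dots> = (\<integral>\<^sup>+\<omega>. (if t < f \<omega> then 1 else 0) \<partial>M)"
      by (intro nn_integral_cong) (auto simp: indicator_def)
    finally show "emeasure M {\<omega> \<in> space M. t < f \<omega>} = (\<integral>\<^sup>+\<omega>. (if t < f \<omega> then 1 else 0) \<partial>M)" .
  qed
  then show ?thesis by simp
qed

text \<open>Tonelli applied to the region \<open>0 \<le> t < f \<omega>\<close>. Restricting
  \<open>t\<close> to \<open>{0..}\<close> matches the truncation of negative values by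
  \<open>ennreal\<close>, so \<open>f\<close> may take any sign.\<close>

lemma nn_integral_eq_integral_tail:
  fixes f :: "'a \<Rightarrow> real"
  assumes "sigma_finite_measure M" and [measurable]: "f \<in> borel_measurable M"
  shows "(\<integral>\<^sup>+\<omega>. ennreal (f \<omega>) \<partial>M) =
    (\<integral>\<^sup>+t. indicator {0..} t * emeasure M {\<omega> \<in> space M. t < f \<omega>} \<partial>lborel)"
proof -
  interpret M: sigma_finite_measure M by fact
  interpret pair_sigma_finite M lborel by unfold_locales
  have eq: "ennreal (f \<omega>) = (\<integral>\<^sup>+t. (if 0 \<le> t \<and> t < f \<omega> then 1 else 0) \<partial>lborel)" for \<omega>
  proof -
    have "(\<integral>\<^sup>+t. (if 0 \<le> t \<and> t < f \<omega> then 1 else 0) \<partial>lborel) =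
        (\<integral>\<^sup>+t. indicator {0..<f \<omega>} t \<partial>lborel)"
      by (intro nn_integral_cong) (auto simp: indicator_def)
    then show ?thesis
      by (cases "0 \<le> f \<omega>") (auto simp: ennreal_neg)
  qed
  have "(\<integral>\<^sup>+\<omega>. ennreal (f \<omega>) \<partial>M) =
      (\<integral>\<^sup>+\<omega>. (\<integral>\<^sup>+t. (if 0 \<le> t \<and> t < f \<omega> then 1 else 0) \<partial>lborel) \<partial>M)"
    unfolding eq ..
  also have "\<dots> = (\<integral>\<^sup>+t. (\<integral>\<^sup>+\<omega>. (if 0 \<le> t \<and> t < f \<omega> then 1 else 0) \<partial>M) \<partial>lborel)"
    by (rule Fubini'[symmetric]) measurable
  also have "\<dots> = (\<integral>\<^sup>+t. indicator {0..} t * emeasure M {\<omega> \<in> space M. t < f \<omega>} \<partial>lborel)"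
  proof (intro nn_integral_cong)
    fix t :: real
    have "(\<integral>\<^sup>+\<omega>. (if 0 \<le> t \<and> t < f \<omega> then 1 else 0) \<partial>M) =
        (\<integral>\<^sup>+\<omega>. indicator {0..} t * indicator {\<omega> \<in> space M. t < f \<omega>} \<omega> \<partial>M)"
      by (intro nn_integral_cong) (auto simp: indicator_def)
    then show "(\<integral>\<^sup>+\<omega>. (if 0 \<le> t \<and> t < f \<omega> then 1 else 0) \<partial>M) =
        indicator {0..} t * emeasure M {\<omega> \<in> space M. t < f \<omega>}"
      by (simp add: nn_integral_cmult)
  qed
  finally show ?thesis .
qed

section \<open>The picked value as a function of the observed values\<close>

lemma picked_value_first:
  assumes "i \<in> {1..n}" "\<theta> i \<le> x i" "\<And>j. j \<in> {1..<i} \<Longrightarrow> x j < \<theta> j"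
  shows "picked_value n \<theta> x = x i"
proof -
  have "(LEAST i. i \<in> {1..n} \<and> \<theta> i \<le> x i) = i"
    using assms by (intro Least_equality) (auto simp: not_less[symmetric])
  then show ?thesis
    using assms unfolding picked_value_def by auto
qed

text \<open>At most one summand can be nonzero, that of the first accepted item. Replacing
  \<open>LEAST\<close> by a finite sum makes measurability evident.\<close>

lemma picked_value_eq_sum:
  "picked_value n \<theta> x =
    (\<Sum>i=1..n. if \<theta> i \<le> x i \<and> (\<forall>j\<in>{1..<i}. x j < \<theta> j) then x i else 0)"
proof (cases "\<exists>i\<in>{1..n}. \<theta> i \<le> x i")
  case False
  then have "(\<Sum>i=1..n. if \<theta> i \<le> x i \<and> (\<forall>j\<in>{1..<i}. x j < \<theta> j) then x i else 0) = 0"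
    by (intro sum.neutral) auto
  with False show ?thesis
    unfolding picked_value_def by auto
next
  case True
  define k where "k = (LEAST i. i \<in> {1..n} \<and> \<theta> i \<le> x i)"
  have k: "k \<in> {1..n}" "\<theta> k \<le> x k"
    using True LeastI_ex[of "\<lambda>i. i \<in> {1..n} \<and> \<theta> i \<le> x i"] unfolding k_def by blast+
  have lt: "x j < \<theta> j" if "j \<in> {1..<k}" for j
    using not_less_Least[of j "\<lambda>i. i \<in> {1..n} \<and> \<theta> i \<le> x i"] that k by (auto simp: k_def)
  have "(\<theta> i \<le> x i \<and> (\<forall>j\<in>{1..<i}. x j < \<theta> j)) \<longleftrightarrow> i = k" if "i \<in> {1..n}" for i
  proof
    assume i: "\<theta> i \<le> x i \<and> (\<forall>j\<in>{1..<i}. x j < \<theta> j)"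
    have "\<not> i < k"
      using lt[of i] i that by auto
    moreover have "\<not> k < i"
      using i k by force
    ultimately show "i = k" by simp
  qed (use k lt in auto)
  then have "(\<Sum>i=1..n. if \<theta> i \<le> x i \<and> (\<forall>j\<in>{1..<i}. x j < \<theta> j) then x i else 0) =
      (\<Sum>i=1..n. if i = k then x i else 0)"
    by (intro sum.cong) auto
  also have "\<dots> = x k"
    using k by simp
  finally show ?thesis
    using picked_value_first[of k n \<theta> x] k lt by simp
qed

lemma picked_value_measurable:
  assumes [measurable]: "\<And>i. i \<in> {1..n} \<Longrightarrow> X i \<in> borel_measurable M"
  shows "(\<lambda>\<omega>. picked_value n \<theta> (\<lambda>i. X i \<omega>)) \<in> borel_measurable M"
  unfolding picked_value_eq_sum
proof (intro borel_measurable_sum)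
  fix i assume i: "i \<in> {1..n}"
  then have [measurable]: "X j \<in> borel_measurable M" if "j \<in> {1..<i}" for j
    using that by auto
  from i have [measurable]: "X i \<in> borel_measurable M"
    by auto
  show "(\<lambda>\<omega>. if \<theta> i \<le> X i \<omega> \<and> (\<forall>j\<in>{1..<i}. X j \<omega> < \<theta> j) then X i \<omega> else 0) \<in> borel_measurable M"
    by measurable
qed

section \<open>Independent items with a common continuous distribution function\<close>

locale iid_continuous_items = prob_space M for M :: "'a measure" +
  fixes n :: nat and X :: "nat \<Rightarrow> 'a \<Rightarrow> real" and F :: "real \<Rightarrow> real"
  assumes n: "1 \<le> n"
    and indep: "indep_vars (\<lambda>_. borel) X {1..n}"
    and cdf: "\<And>i. i \<in> {1..n} \<Longrightarrow> cdf (distr M borel (X i)) = F"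
    and cont: "continuous_on UNIV F"
begin

lemma measurable_X: "i \<in> {1..n} \<Longrightarrow> X i \<in> borel_measurable M"
  using indep unfolding indep_vars_def by auto

lemma distribution: "i \<in> {1..n} \<Longrightarrow> real_distribution (distr M borel (X i))"
  using measurable_X by simp

lemma prob_le: "i \<in> {1..n} \<Longrightarrow> prob (X i -` {..t} \<inter> space M) = F t"
  using cdf[of i] measurable_X[of i] by (auto simp: cdf_def measure_distr)

text \<open>Continuity of \<open>F\<close> excludes atoms. Rejection is a strict inequality, so this
  is what gives it probability \<open>F\<close> of the threshold.\<close>

lemma prob_less:
  assumes i: "i \<in> {1..n}"
  shows "prob (X i -` {..<t} \<inter> space M) = F t"
proof -
  interpret D: real_distribution "distr M borel (X i)"
    using i by (rule distribution)
  have "isCont F t"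
    using cont by (simp add: continuous_on_eq_continuous_at)
  then have "measure (distr M borel (X i)) {t} = 0"
    using D.isCont_cdf[of t] cdf[OF i] by simp
  moreover have "measure (distr M borel (X i)) ({..<t} \<union> {t}) =
      measure (distr M borel (X i)) {..<t} + measure (distr M borel (X i)) {t}"
    by (intro D.finite_measure_Union) auto
  moreover have "{..<t} \<union> {t} = {..t}"
    by auto
  ultimately show ?thesis
    using cdf[OF i] measurable_X[OF i] by (simp add: cdf_def measure_distr fun_eq_iff)
qed

lemma prob_greater:
  assumes i: "i \<in> {1..n}"
  shows "prob (X i -` {t<..} \<inter> space M) = 1 - F t"
proof -
  have "X i -` {t<..} \<inter> space M = space M - X i -` {..t} \<inter> space M"
    by auto
  then show ?thesis
    using prob_compl[of "X i -` {..t} \<inter> space M"] prob_le[OF i] measurable_X[OF i]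
    by (simp add: measurable_sets)
qed

lemma F_nonneg: "0 \<le> F t" and F_le_1: "F t \<le> 1"
  using prob_le[of 1 t] n by (metis atLeastAtMost_iff le_refl measure_nonneg prob_le_1)+

lemma F_mono: "mono F"
proof (rule monoI)
  fix s t :: real assume "s \<le> t"
  then have "prob (X 1 -` {..s} \<inter> space M) \<le> prob (X 1 -` {..t} \<inter> space M)"
    using n measurable_X[of 1] by (intro finite_measure_mono) (auto simp: measurable_sets)
  then show "F s \<le> F t"
    using prob_le[of 1] n by simp
qed

lemma F_intermediate:
  assumes "0 < y" "y < 1"
  obtains x where "F x = y"
proof -
  interpret D: real_distribution "distr M borel (X 1)"
    using n by (intro distribution) auto
  have F: "cdf (distr M borel (X 1)) = F"
    using cdf n by simp
  have "\<forall>\<^sub>F x in at_bot. F x < y" "\<forall>\<^sub>F x in at_top. y < F x"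
    using D.cdf_lim_at_bot D.cdf_lim_at_top_prob assms unfolding F
    by (auto intro: order_tendstoD)
  then obtain a b where "F a < y" "y < F b"
    by (auto simp: eventually_at_bot_linorder eventually_at_top_linorder)
  moreover from this have "a \<le> b"
    using F_mono[THEN monoD, of b a] by force
  ultimately show thesis
    using IVT'[of F a y b] cont that by (meson continuous_on_subset less_imp_le subset_UNIV)
qed

lemma prob_Max_greater:
  "prob {\<omega> \<in> space M. t < Max ((\<lambda>i. X i \<omega>) ` {1..n})} = 1 - F t ^ n"
proof -
  let ?A = "\<Inter>i\<in>{1..n}. X i -` {..t} \<inter> space M"
  have "{\<omega> \<in> space M. t < Max ((\<lambda>i. X i \<omega>) ` {1..n})} = space M - ?A"
    using n by (subst Max_gr_iff) (auto simp: not_le[symmetric])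
  moreover have "prob ?A = F t ^ n"
    using indep_varsD[OF indep, of "{1..n}" "\<lambda>_. {..t}"] n prob_le by simp
  moreover have "?A \<in> events"
    using n measurable_X by (intro sets.finite_INT) (auto simp: measurable_sets)
  ultimately show ?thesis
    using prob_compl[of ?A] by simp
qed

text \<open>Split by the index \<open>i\<close> of the accepted item: by independence, the earlier
  rejections contribute the product, and item \<open>i\<close> must exceed both its threshold and
  \<open>t\<close>.\<close>

lemma prob_picked_value_greater:
  assumes t: "0 \<le> t"
  shows "(\<Sum>i=1..n. (\<Prod>j=1..<i. F (\<theta> j)) * (1 - max (F (\<theta> i)) (F t)))
    \<le> prob {\<omega> \<in> space M. t < picked_value n \<theta> (\<lambda>i. X i \<omega>)}"
proof -
  \<comment> \<open>The open half-line drops only the null event that item \<open>i\<close> equals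
    the larger of \<open>\<theta> i\<close> and \<open>t\<close>, which is harmless for a lower
    bound.\<close>
  define S where "S i j = (if j < i then {..<\<theta> j} else {max (\<theta> i) t<..})" for i j
  define A where "A i = (\<Inter>j\<in>{1..i}. X j -` S i j \<inter> space M)" for i
  have A_iff: "\<omega> \<in> A i \<longleftrightarrow>
      \<omega> \<in> space M \<and> (\<forall>j\<in>{1..<i}. X j \<omega> < \<theta> j) \<and> \<theta> i < X i \<omega> \<and> t < X i \<omega>"
    if "i \<in> {1..n}" for i \<omega>
    using that unfolding A_def S_def by (auto split: if_splits)
  have events: "A i \<in> events" if "i \<in> {1..n}" for i
    unfolding A_def using that measurable_X
    by (intro sets.finite_INT) (auto simp: S_def intro!: measurable_sets)
  have prob_A: "prob (A i) = (\<Prod>j=1..<i. F (\<theta> j)) * (1 - max (F (\<theta> i)) (F t))"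
    if i: "i \<in> {1..n}" for i
  proof -
    have "prob (A i) = (\<Prod>j=1..i. prob (X j -` S i j \<inter> space M))"
      unfolding A_def using i by (intro indep_varsD[OF indep]) (auto simp: S_def)
    also have "{1..i} = insert i {1..<i}"
      using i by auto
    also have "(\<Prod>j\<in>insert i {1..<i}. prob (X j -` S i j \<inter> space M)) =
        prob (X i -` S i i \<inter> space M) * (\<Prod>j=1..<i. prob (X j -` S i j \<inter> space M))"
      by simp
    also have "(\<Prod>j=1..<i. prob (X j -` S i j \<inter> space M)) = (\<Prod>j=1..<i. F (\<theta> j))"
      using i by (intro prod.cong) (auto simp: S_def prob_less)
    also have "prob (X i -` S i i \<inter> space M) = 1 - max (F (\<theta> i)) (F t)"
      using i prob_greater[OF i, of "max (\<theta> i) t"] F_mono by (simp add: S_def max_of_mono)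
    finally show ?thesis by simp
  qed
  have disj: "disjoint_family_on A {1..n}"
    unfolding disjoint_family_on_def
  proof (intro ballI impI)
    fix i j assume ij: "i \<in> {1..n}" "j \<in> {1..n}" "i \<noteq> j"
    \<comment> \<open>The earlier item \<open>k\<close> would have to be accepted for
      \<open>A k\<close> and rejected for \<open>A l\<close>.\<close>
    have "\<omega> \<notin> A l" if "\<omega> \<in> A k" "k < l" "k \<in> {1..n}" "l \<in> {1..n}" for k l \<omega>
    proof
      assume "\<omega> \<in> A l"
      then have "X k \<omega> < \<theta> k" "\<theta> k < X k \<omega>"
        using that by (auto simp: A_iff)
      then show False by simp
    qed
    then show "A i \<inter> A j = {}"
      using ij by (metis disjoint_iff linorder_neqE_nat)
  qed
  have meas: "{\<omega> \<in> space M. t < picked_value n \<theta> (\<lambda>i. X i \<omega>)} \<in> events"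
    using picked_value_measurable[of n X M \<theta>] measurable_X by measurable
  have "(\<Sum>i=1..n. (\<Prod>j=1..<i. F (\<theta> j)) * (1 - max (F (\<theta> i)) (F t))) = (\<Sum>i=1..n. prob (A i))"
    using prob_A by simp
  also have "\<dots> = prob (\<Union>i\<in>{1..n}. A i)"
    using events disj by (intro finite_measure_finite_Union[symmetric]) auto
  also have "\<dots> \<le> prob {\<omega> \<in> space M. t < picked_value n \<theta> (\<lambda>i. X i \<omega>)}"
  proof (intro finite_measure_mono meas subsetI)
    fix \<omega> assume "\<omega> \<in> (\<Union>i\<in>{1..n}. A i)"
    then obtain i where "i \<in> {1..n}" "\<omega> \<in> A i" by blast
    then show "\<omega> \<in> {\<omega> \<in> space M. t < picked_value n \<theta> (\<lambda>i. X i \<omega>)}"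
      using picked_value_first[of i n \<theta> "\<lambda>i. X i \<omega>"] by (auto simp: A_iff)
  qed
  finally show ?thesis .
qed

lemma strong_threshold_prob_picked_value_greater:
  assumes \<alpha>: "0 < \<alpha>" and h: "strong_threshold \<alpha> h" and t: "0 \<le> t"
    and \<theta>: "\<And>i. i \<in> {1..n} \<Longrightarrow> F (\<theta> i) = h (real i / real n) / h ((real i - 1) / real n)"
  shows "\<alpha> * prob {\<omega> \<in> space M. t < Max ((\<lambda>i. X i \<omega>) ` {1..n})}
    \<le> (1 + 2 / real n) * prob {\<omega> \<in> space M. t < picked_value n \<theta> (\<lambda>i. X i \<omega>)}"
proof -
  from h have h0: "h 0 = 1" and pos: "\<And>s. s \<in> {0..1} \<Longrightarrow> 0 < h s"
    unfolding strong_threshold_def threshold_function_def by auto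
  have pos': "0 < h (real i / real n)" if "i \<le> n" for i
    using that by (intro pos) (auto simp: divide_simps)
  \<comment> \<open>The threshold levels are consecutive ratios of \<open>h\<close>, so their
    product telescopes down to \<open>h 0 = 1\<close>.\<close>
  have reach: "(\<Prod>j=1..<Suc i. F (\<theta> j)) = h (real i / real n)" if "i < n" for i
    using that
  proof (induction i)
    case 0
    then show ?case by (simp add: h0)
  next
    case (Suc i)
    then have "(\<Prod>j=1..<Suc (Suc i). F (\<theta> j)) = h (real i / real n) * F (\<theta> (Suc i))"
      by simp
    then show ?case
      using Suc.prems pos'[of i] by (simp add: \<theta>)
  qed
  \<comment> \<open>Multiplying the minimum of the two exceedance probabilities by the reach
    probability \<open>h (i/n)\<close> turns \<open>1 - F (\<theta> (i+1))\<close> into a decrement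
    of \<open>h\<close>.\<close>
  have summand: "(\<Prod>j=1..<Suc i. F (\<theta> j)) * (1 - max (F (\<theta> (Suc i))) (F t)) =
      min (h (real i / real n) - h (real (Suc i) / real n)) ((1 - F t) * h (real i / real n))"
    if "i < n" for i
  proof -
    have q: "F (\<theta> (Suc i)) = h (real (Suc i) / real n) / h (real i / real n)"
      using that by (simp add: \<theta>)
    have p: "0 < h (real i / real n)"
      using pos' that by simp
    have "1 - max (F (\<theta> (Suc i))) (F t) = min (1 - F (\<theta> (Suc i))) (1 - F t)"
      by (simp add: min_def max_def)
    moreover have "h (real i / real n) * min (1 - F (\<theta> (Suc i))) (1 - F t) =
      min (h (real i / real n) * (1 - F (\<theta> (Suc i)))) (h (real i / real n) * (1 - F t))"
      using p by (simp add: min_mult_distrib_left)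
    ultimately show ?thesis
      using p unfolding reach[OF that] q by (simp add: right_diff_distrib mult.commute)
  qed
  have "(\<Sum>i=1..n. (\<Prod>j=1..<i. F (\<theta> j)) * (1 - max (F (\<theta> i)) (F t))) =
      (\<Sum>i<n. (\<Prod>j=1..<Suc i. F (\<theta> j)) * (1 - max (F (\<theta> (Suc i))) (F t)))"
    by (rule sum.reindex_bij_witness[where j = "\<lambda>i. i - 1" and i = Suc]) auto
  also have "\<dots> = (\<Sum>i<n. min (h (real i / real n) - h (real (Suc i) / real n))
      ((1 - F t) * h (real i / real n)))"
    using summand by (intro sum.cong) auto
  finally have "(\<Sum>i<n. min (h (real i / real n) - h (real (Suc i) / real n))
      ((1 - F t) * h (real i / real n))) \<le> prob {\<omega> \<in> space M. t < picked_value n \<theta> (\<lambda>i. X i \<omega>)}"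
    using prob_picked_value_greater[OF t, of \<theta>] by simp
  moreover have "\<alpha> * (1 - F t ^ n) \<le> (1 + 2 / real n) *
    (\<Sum>i<n. min (h (real i / real n) - h (real (Suc i) / real n))
      ((1 - F t) * h (real i / real n)))"
    using strong_threshold_tail_bound[OF \<alpha> h n, of "1 - F t"] F_nonneg F_le_1 by simp
  ultimately show ?thesis
    unfolding prob_Max_greater by (smt (verit) divide_nonneg_nonneg mult_left_mono of_nat_0_le_iff)
qed

text \<open>The tail comparison holds at every level \<open>t \<ge> 0\<close> with the same factor,
  so it survives integration over \<open>t\<close>, even when the expectations are infinite.\<close>

lemma strong_threshold_nn_integral_picked_value:
  assumes \<alpha>: "0 < \<alpha>" and h: "strong_threshold \<alpha> h"
    and \<theta>: "\<And>i. i \<in> {1..n} \<Longrightarrow> F (\<theta> i) = h (real i / real n) / h ((real i - 1) / real n)"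
    and K: "0 \<le> K" "K * (1 + 2 / real n) \<le> \<alpha>"
  shows "ennreal K * (\<integral>\<^sup>+\<omega>. ennreal (Max ((\<lambda>i. X i \<omega>) ` {1..n})) \<partial>M)
      \<le> (\<integral>\<^sup>+\<omega>. ennreal (picked_value n \<theta> (\<lambda>i. X i \<omega>)) \<partial>M)"
proof -
  let ?A = "\<lambda>t. {\<omega> \<in> space M. t < Max ((\<lambda>i. X i \<omega>) ` {1..n})}"
  let ?B = "\<lambda>t. {\<omega> \<in> space M. t < picked_value n \<theta> (\<lambda>i. X i \<omega>)}"
  have Max_meas: "(\<lambda>\<omega>. Max ((\<lambda>i. X i \<omega>) ` {1..n})) \<in> borel_measurable M"
    using measurable_X by (intro borel_measurable_Max) auto
  have [measurable]: "(\<lambda>\<omega>. picked_value n \<theta> (\<lambda>i. X i \<omega>)) \<in> borel_measurable M"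
    using measurable_X by (intro picked_value_measurable) auto
  have le: "ennreal K * emeasure M (?A t) \<le> emeasure M (?B t)" if "0 \<le> t" for t
  proof -
    have "K * (1 + 2 / real n) * prob (?A t) \<le> (1 + 2 / real n) * prob (?B t)"
      using strong_threshold_prob_picked_value_greater[OF \<alpha> h that \<theta>] K
      by (meson measure_nonneg mult_right_mono order_trans)
    then have "(1 + 2 / real n) * (K * prob (?A t)) \<le> (1 + 2 / real n) * prob (?B t)"
      by (simp add: mult_ac)
    moreover have "0 < 1 + 2 / real n"
      by (simp add: add_pos_nonneg)
    ultimately have "K * prob (?A t) \<le> prob (?B t)"
      by (simp only: mult_le_cancel_left_pos)
    then show ?thesis
      using K by (simp add: emeasure_eq_measure ennreal_mult[symmetric] ennreal_leI)
  qed
  have "ennreal K * (\<integral>\<^sup>+\<omega>. ennreal (Max ((\<lambda>i. X i \<omega>) ` {1..n})) \<partial>M) =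
      (\<integral>\<^sup>+t. ennreal K * (indicator {0..} t * emeasure M (?A t)) \<partial>lborel)"
    unfolding nn_integral_eq_integral_tail[OF sigma_finite_measure_axioms Max_meas]
    by (intro nn_integral_cmult[symmetric] borel_measurable_times_ennreal borel_measurable_indicator
        borel_measurable_tail[OF sigma_finite_measure_axioms Max_meas]) simp
  also have "\<dots> \<le> (\<integral>\<^sup>+t. indicator {0..} t * emeasure M (?B t) \<partial>lborel)"
    using le by (intro nn_integral_mono) (auto simp: indicator_def)
  also have "\<dots> = (\<integral>\<^sup>+\<omega>. ennreal (picked_value n \<theta> (\<lambda>i. X i \<omega>)) \<partial>M)"
    by (subst nn_integral_eq_integral_tail) (auto intro!: sigma_finite_measure_axioms)
  finally show ?thesis .
qed

text \<open>Since \<open>h\<close> is positive and strictly decreasing, the prescribed level lies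
  strictly between 0 and 1. There \<open>F\<close> attains it, necessarily inside \<open>I\<close>,
  where \<open>F\<close> is injective; so \<open>the_inv_into\<close> is a genuine inverse at this
  level.\<close>

lemma F_threshold:
  assumes h: "threshold_function h" and F: "continuous_increasing_on_interval F I"
    and i: "i \<in> {1..n}"
  shows "F (threshold h F I n i) = h (real i / real n) / h ((real i - 1) / real n)"
proof -
  let ?q = "h (real i / real n) / h ((real i - 1) / real n)"
  have dom: "real i / real n \<in> {0..1}" "(real i - 1) / real n \<in> {0..1}"
    "(real i - 1) / real n < real i / real n"
    using i by (auto simp: divide_simps)
  have "0 < h (real i / real n)" "0 < h ((real i - 1) / real n)"
    "h (real i / real n) < h ((real i - 1) / real n)"
    using h dom unfolding threshold_function_def by (auto simp: monotone_on_def)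
  then have q: "0 < ?q" "?q < 1"
    by auto
  then obtain x where x: "F x = ?q"
    by (rule F_intermediate)
  then have "x \<in> I" and "inj_on F I"
    using F q unfolding continuous_increasing_on_interval_def
    by (auto intro: strict_mono_on_imp_inj_on)
  then show ?thesis
    using f_the_inv_into_f[of F I ?q] x unfolding threshold_def by (metis imageI)
qed

end

section \<open>From the factor \<open>1 + 2/n\<close> to \<open>1 - \<epsilon>\<close>\<close>

theorem theorem6:
  fixes \<alpha> :: real and h F :: "real \<Rightarrow> real" and I :: "real set"
  assumes "0 < \<alpha>" and "\<alpha> \<le> 1"
    and "strong_threshold \<alpha> h"
    and "nonneg_distribution_function F"
    and "continuous_increasing_on_interval F I"
  shows "\<forall>\<epsilon>>0. \<exists>n\<^sub>\<epsilon>\<ge>1. \<forall>n\<ge>n\<^sub>\<epsilon>. \<forall>(M :: 'a measure) X. iid_items M n X F \<longrightarrow>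
    ennreal ((1 - \<epsilon>) * \<alpha>) * (\<integral>\<^sup>+\<omega>. ennreal (Max ((\<lambda>i. X i \<omega>) ` {1..n})) \<partial>M)
      \<le> (\<integral>\<^sup>+\<omega>. ennreal (picked_value n (threshold h F I n) (\<lambda>i. X i \<omega>)) \<partial>M)"
proof (intro allI impI)
  fix \<epsilon> :: real assume \<epsilon>: "0 < \<epsilon>"
  \<comment> \<open>For \<open>n \<ge> N\<close> this gives \<open>2/n \<le> \<epsilon>\<close>, and
    \<open>(1 - \<epsilon>) * (1 + \<epsilon>) \<le> 1\<close> then absorbs the error factor. The
    choice depends on \<epsilon> alone.\<close>
  obtain N :: nat where N: "2 / \<epsilon> < real N"
    using reals_Archimedean2 by blast
  show "\<exists>n\<^sub>\<epsilon>\<ge>1. \<forall>n\<ge>n\<^sub>\<epsilon>. \<forall>(M :: 'a measure) X. iid_items M n X F \<longrightarrow>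
    ennreal ((1 - \<epsilon>) * \<alpha>) * (\<integral>\<^sup>+\<omega>. ennreal (Max ((\<lambda>i. X i \<omega>) ` {1..n})) \<partial>M)
      \<le> (\<integral>\<^sup>+\<omega>. ennreal (picked_value n (threshold h F I n) (\<lambda>i. X i \<omega>)) \<partial>M)"
  proof (intro exI[of _ "max N 1"] conjI allI impI)
    fix n :: nat and M :: "'a measure" and X
    assume nN: "max N 1 \<le> n" and iid: "iid_items M n X F"
    show "ennreal ((1 - \<epsilon>) * \<alpha>) * (\<integral>\<^sup>+\<omega>. ennreal (Max ((\<lambda>i. X i \<omega>) ` {1..n})) \<partial>M)
      \<le> (\<integral>\<^sup>+\<omega>. ennreal (picked_value n (threshold h F I n) (\<lambda>i. X i \<omega>)) \<partial>M)"
    proof (cases "\<epsilon> \<le> 1")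
      \<comment> \<open>For \<epsilon> above 1 the factor is at most 0, and \<open>ennreal\<close>
        truncates it to 0.\<close>
      case False
      then have "(1 - \<epsilon>) * \<alpha> \<le> 0"
        using assms(1) by (simp add: mult_nonpos_nonneg)
      then show ?thesis
        by (simp add: ennreal_neg)
    next
      case True
      interpret iid_continuous_items M n X F
        using iid nN assms(5)
        unfolding iid_items_def continuous_increasing_on_interval_def
          iid_continuous_items_def iid_continuous_items_axioms_def by auto
      have "2 / real n \<le> \<epsilon>"
      proof -
        have "2 < \<epsilon> * real N" using N \<epsilon> by (simp add: field_simps)
        also have "\<dots> \<le> \<epsilon> * real n" using nN \<epsilon> by (intro mult_left_mono) auto
        finally show ?thesis using n by (simp add: field_simps)
      qed
      then have "(1 - \<epsilon>) * (1 + 2 / real n) \<le> (1 - \<epsilon>) * (1 + \<epsilon>)"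
        using True by (intro mult_left_mono) auto
      also have "\<dots> \<le> 1"
        by (simp add: algebra_simps)
      finally have "\<alpha> * ((1 - \<epsilon>) * (1 + 2 / real n)) \<le> \<alpha> * 1"
        using assms(1) by (intro mult_left_mono) auto
      then have K: "(1 - \<epsilon>) * \<alpha> * (1 + 2 / real n) \<le> \<alpha>"
        by (simp add: mult_ac)
      have "threshold_function h"
        using assms(3) by (simp add: strong_threshold_def)
      then show ?thesis
        using assms(1,3,5) True K
        by (intro strong_threshold_nn_integral_picked_value[of \<alpha> h] F_threshold) simp_all
    qed
  qed simp
qed

end
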